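(* Let $A$ be a generalized Cartan matrix with associated data $\mathfrak h_{\mathbb R}^*,\Pi,W,\overline C$, let $\mu\in\overline C$, let $H$ be the convex hull of $W\mu$, and let $I\subseteq\Pi$ be any subset. Let $F_I$ be the convex hull of $W_I\mu$. Then $F_I$ is an exposed fundamental face of $H$, and $$F_I=H\cap(\mu-\mathbb R_+I)=W_I(F_I\cap\overline C).$$ Moreover, $W_I\mu=F_I\cap W\mu$.
   Context: Let $A=(a_{ij})_{i,j=1}^m$ be a generalized Cartan matrix (integral, $a_{ii}=2$, $a_{ij}\le 0$ for $i\ne j$, $a_{ij}=0\Rightarrow a_{ji}=0$) of rank $l$. Let $(\mathfrak h_{\mathbb R},\Pi,\Pi^\vee)$ be a realization of $A$ over $\mathbb R$: $\mathfrak h_{\mathbb R}$ is a real vector space of dimension $2m-l$, and $\Pi=\{\alpha_1,\dots,\alpha_m\}\subset\mathfrak h_{\mathbb R}^*$ and $\Pi^\vee=\{\alpha_1^\vee,\dots,\alpha_m^\vee\}\subset\mathfrak h_{\mathbb R}$ are linearly independent with $\langle\alpha_j,\alpha_i^\vee\rangle=a_{ij}$. The Weyl group $W\subset GL(\mathfrak h_{\mathbb R}^* )$ is generated by the reflections $r_{\alpha_i}(\eta)=\eta-\langle\eta,\alpha_i^\vee\rangle\alpha_i$. For $I\subseteq\Pi$, $W_I$ is the subgroup generated by $r_\alpha$, $\alpha\in I$. The fundamental chamber is $\overline C=\{\eta\in\mathfrak h_{\mathbb R}^*\mid\langle\eta,\alpha^\vee\rangle\ge 0\ \forall\alpha\in\Pi\}$.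 A face of the convex set $H$ is a convex subset $F\subseteq H$ such that every closed line segment in $H$ having a relative interior point in $F$ has both endpoints in $F$ (so $\emptyset$ and $H$ are faces). An exposed face is $H$ itself or the set of points of $H$ at which some linear functional attains its maximum over $H$. A face $F$ is fundamental if $F=\emptyset$ or $\operatorname{ri}(F)\cap\overline C\ne\emptyset$, where $\operatorname{ri}$ denotes relative interior. $\mathbb R_+I=\{\sum_{\alpha\in I}m_\alpha\alpha\mid m_\alpha\ge 0\}$. *)

theory Defs
  imports "HOL-Analysis.Analysis" "HOL-Algebra.Generated_Groups"
begin

definition generalized_cartan_matrix :: "int^'n^'n \<Rightarrow> bool" where
  "generalized_cartan_matrix A \<longleftrightarrow>
     (\<forall>i. A $ i $ i = 2) \<and>
     (\<forall>i j. i \<noteq> j \<longrightarrow> A $ i $ j \<le> 0) \<and>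
     (\<forall>i j. A $ i $ j = 0 \<longrightarrow> A $ j $ i = 0)"

text \<open>
  The real vector space \<open>\<hh>\<close> is the type \<open>'h\<close>, a Euclidean space whose inner product is never used.
  As \<open>'h\<close> is finite-dimensional, every linear functional on it is bounded, so \<open>'h \<Rightarrow>\<^sub>L real\<close> is the
  full dual space \<open>\<hh>\<^sup>*\<close>, and the pairing \<open>\<langle>\<eta>, h\<rangle>\<close> is \<open>blinfun_apply \<eta> h\<close>.  Simple roots \<open>\<alpha>\<close> and simple
  coroots \<open>\<alpha>v\<close> are families over the index type \<open>'n\<close> of the Cartan matrix.  They are required to be
  injective, so subsets of \<open>\<Pi>\<close> are the same as sets of indices.
\<close>

definition realization ::
  "int^'n^'n \<Rightarrow> ('n \<Rightarrow> ('h::euclidean_space \<Rightarrow>\<^sub>L real)) \<Rightarrow> ('n \<Rightarrow> 'h) \<Rightarrow> bool" where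
  "realization A \<alpha> \<alpha>v \<longleftrightarrow>
     DIM('h) = 2 * CARD('n) - rank (map_matrix real_of_int A) \<and>
     inj \<alpha> \<and> independent (range \<alpha>) \<and>
     inj \<alpha>v \<and> independent (range \<alpha>v) \<and>
     (\<forall>i j. blinfun_apply (\<alpha> j) (\<alpha>v i) = real_of_int (A $ i $ j))"

definition GL :: "('v::real_vector \<Rightarrow> 'v) monoid" where
  "GL = \<lparr>carrier = {f. linear f \<and> bij f}, mult = (\<circ>), one = id\<rparr>"

lemma group_GL: "group (GL :: ('v::real_vector \<Rightarrow> 'v) monoid)"
proof (rule groupI)
  fix f :: "'v \<Rightarrow> 'v" assume "f \<in> carrier GL"
  then have f: "linear f" "bij f" by (auto simp: GL_def)
  have "linear (inv_into UNIV f)"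
    using f by (intro linearI)
      (auto intro!: inv_f_eq simp: bij_def linear_add linear_scale surj_f_inv_f)
  then have "inv_into UNIV f \<in> carrier GL"
    using f(2) by (simp add: GL_def bij_imp_bij_inv)
  moreover have "inv_into UNIV f \<circ> f = id" using f(2) by (simp add: bij_def)
  ultimately show "\<exists>g\<in>carrier GL. g \<otimes>\<^bsub>GL\<^esub> f = \<one>\<^bsub>GL\<^esub>" by (auto simp: GL_def)
qed (auto simp: GL_def linear_compose bij_comp linear_id comp_assoc)

definition simple_reflection ::
  "('n \<Rightarrow> ('h::euclidean_space \<Rightarrow>\<^sub>L real)) \<Rightarrow> ('n \<Rightarrow> 'h) \<Rightarrow> 'n \<Rightarrow> ('h \<Rightarrow>\<^sub>L real) \<Rightarrow> ('h \<Rightarrow>\<^sub>L real)" where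
  "simple_reflection \<alpha> \<alpha>v i \<eta> = \<eta> - blinfun_apply \<eta> (\<alpha>v i) *\<^sub>R \<alpha> i"

lemma simple_reflection_in_GL:
  assumes "generalized_cartan_matrix A" "realization A \<alpha> \<alpha>v"
  shows "simple_reflection \<alpha> \<alpha>v i \<in> carrier GL"
proof -
  have "blinfun_apply (\<alpha> i) (\<alpha>v i) = 2"
    using assms by (simp add: generalized_cartan_matrix_def realization_def)
  then have "simple_reflection \<alpha> \<alpha>v i \<circ> simple_reflection \<alpha> \<alpha>v i = id"
    by (auto simp: simple_reflection_def fun_eq_iff blinfun.diff_left blinfun.scaleR_left
        algebra_simps simp flip: scaleR_add_left)
  moreover have "linear (simple_reflection \<alpha> \<alpha>v i)"
    by (rule linearI)
      (auto simp: simple_reflection_def blinfun.add_left blinfun.scaleR_left algebra_simps)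
  ultimately show ?thesis by (auto simp: GL_def intro: o_bij)
qed

text \<open>The subgroup \<open>W\<^sub>I\<close>; the Weyl group itself is the case \<open>I = UNIV\<close>.\<close>

definition weyl_subgroup ::
  "('n \<Rightarrow> ('h::euclidean_space \<Rightarrow>\<^sub>L real)) \<Rightarrow> ('n \<Rightarrow> 'h) \<Rightarrow> 'n set \<Rightarrow>
   (('h \<Rightarrow>\<^sub>L real) \<Rightarrow> ('h \<Rightarrow>\<^sub>L real)) set" where
  "weyl_subgroup \<alpha> \<alpha>v I = generate GL (simple_reflection \<alpha> \<alpha>v ` I)"

definition weyl_orbit ::
  "('n \<Rightarrow> ('h::euclidean_space \<Rightarrow>\<^sub>L real)) \<Rightarrow> ('n \<Rightarrow> 'h) \<Rightarrow> 'n set \<Rightarrow> ('h \<Rightarrow>\<^sub>L real) \<Rightarrow>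
   ('h \<Rightarrow>\<^sub>L real) set" where
  "weyl_orbit \<alpha> \<alpha>v I \<mu> = (\<lambda>w. w \<mu>) ` weyl_subgroup \<alpha> \<alpha>v I"

definition fundamental_chamber :: "('n \<Rightarrow> 'h::euclidean_space) \<Rightarrow> ('h \<Rightarrow>\<^sub>L real) set" where
  "fundamental_chamber \<alpha>v = {\<eta>. \<forall>i. blinfun_apply \<eta> (\<alpha>v i) \<ge> 0}"

definition nonneg_span :: "('n::finite \<Rightarrow> 'v::real_vector) \<Rightarrow> 'n set \<Rightarrow> 'v set" where
  "nonneg_span \<alpha> I = {\<Sum>i\<in>I. c i *\<^sub>R \<alpha> i | c :: 'n \<Rightarrow> real. \<forall>i\<in>I. c i \<ge> 0}"

text \<open>
  The library's \<open>exposed_face_of\<close> is phrased with an inner product, so it does not apply to sets in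
  the dual space.
\<close>

definition exposed_face :: "'v::real_vector set \<Rightarrow> 'v set \<Rightarrow> bool" where
  "exposed_face F H \<longleftrightarrow>
     F = H \<or> (\<exists>\<phi> :: 'v \<Rightarrow> real. linear \<phi> \<and> F = {x \<in> H. \<forall>y\<in>H. \<phi> y \<le> \<phi> x})"

definition fundamental_face ::
  "('n \<Rightarrow> 'h::euclidean_space) \<Rightarrow> ('h \<Rightarrow>\<^sub>L real) set \<Rightarrow> ('h \<Rightarrow>\<^sub>L real) set \<Rightarrow> bool" where
  "fundamental_face \<alpha>v F H \<longleftrightarrow>
     F face_of H \<and> (F = {} \<or> rel_interior F \<inter> fundamental_chamber \<alpha>v \<noteq> {})"

end

theory Submission
  imports Defs
begin

text \<open>
  Call a weight \<open>\<nu>\<close> reachable from \<open>\<mu>\<close> if it arises by simple reflections, each applied at a strictly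
  positive value \<open>\<langle>\<eta>, \<alpha>\<^sub>i\<^sup>\<or>\<rangle>\<close>; such weights lie in \<open>\<mu> - \<real>\<^sub>+\<Pi>\<close>.  For dominant \<open>\<mu>\<close> the reachable weights are
  closed under all simple reflections, hence form the whole orbit \<open>W\<mu>\<close>.  This is a confluence
  property, which a computation with the pairs \<open>(a\<^sub>i\<^sub>j, a\<^sub>j\<^sub>i)\<close> settles in rank 2 and induction on the
  length of the path settles in general; neither root systems nor lengths of Weyl group elements
  are needed.

  A functional that is \<open>0\<close> on \<open>I\<close> and \<open>1\<close> on \<open>\<Pi> - I\<close> therefore attains its maximum over \<open>H\<close> exactly on
  \<open>H \<inter> (\<mu> - \<real>\<^sub>+I)\<close>, and a path to an orbit point in \<open>\<mu> - \<real>\<^sub>+I\<close> uses only reflections from \<open>I\<close>, so that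
  this set is \<open>F\<^sub>I\<close>.  Points of \<open>F\<^sub>I\<close> can be moved into the chamber by \<open>W\<^sub>I\<close> because heights are discrete;
  applied to a point of the relative interior, which \<open>W\<^sub>I\<close> preserves, this shows that \<open>F\<^sub>I\<close> is
  fundamental.
\<close>

section \<open>Reflections in rank 2\<close>

text \<open>
  A state \<open>(x, y)\<close> stands for \<open>\<xi> - x \<alpha>\<^sub>i - y \<alpha>\<^sub>j\<close>, where \<open>p\<close>, \<open>q\<close> are the values of \<open>\<xi>\<close> at the coroots
  \<open>\<alpha>\<^sub>i\<^sup>\<or>\<close>, \<open>\<alpha>\<^sub>j\<^sup>\<or>\<close> and \<open>a = - a\<^sub>i\<^sub>j\<close>, \<open>b = - a\<^sub>j\<^sub>i\<close>.  Then \<open>p - 2x + ay\<close> and \<open>q + bx - 2y\<close> are the values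
  of the state at the two coroots, and a step is a simple reflection at a positive value.
\<close>

inductive firing :: "real \<Rightarrow> real \<Rightarrow> real \<Rightarrow> real \<Rightarrow> nat \<Rightarrow> real \<Rightarrow> real \<Rightarrow> bool"
  for p q a b where
  start: "firing p q a b 0 0 0"
| fire_x: "firing p q a b n x y \<Longrightarrow> 0 < p - 2 * x + a * y \<Longrightarrow> firing p q a b (Suc n) (p - x + a * y) y"
| fire_y: "firing p q a b n x y \<Longrightarrow> 0 < q + b * x - 2 * y \<Longrightarrow> firing p q a b (Suc n) x (q + b * x - y)"

lemma fire_x_eq:
  "firing p q a b n x y \<Longrightarrow> 0 < p - 2 * x + a * y \<Longrightarrow> x' = p - x + a * y \<Longrightarrow> m = Suc n \<Longrightarrow>
    firing p q a b m x' y"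
  by (simp add: fire_x)

lemma fire_y_eq:
  "firing p q a b n x y \<Longrightarrow> 0 < q + b * x - 2 * y \<Longrightarrow> y' = q + b * x - y \<Longrightarrow> m = Suc n \<Longrightarrow>
    firing p q a b m x y'"
  by (simp add: fire_y)

text \<open>Exchanging the two nodes exchanges \<open>a\<close> and \<open>b\<close>, so types B2
  and G2 also settle the pairs (2, 1) and (3, 1).\<close>

lemma firing_swap_iff: "firing p q a b n x y \<longleftrightarrow> firing q p b a n y x"
proof -
  have "firing q p b a n y x" if "firing p q a b n x y" for p q a b x y
    using that by (induction rule: firing.induct)
      (auto intro: firing.start fire_x_eq fire_y_eq simp: algebra_simps)
  then show ?thesis by blast
qed

text \<open>In each of the four finite types the invariant lists the images of the start under the
  dihedral group, with word lengths as step counts. Only the last can be negative at both coroots,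
  and the two alternating words for the longest element reach it with different final steps.\<close>

lemma firing_confluent_A1_A1:
  assumes "firing p q 0 0 n x y" "0 \<le> p" "0 \<le> q" "p - 2 * x + 0 * y < 0" "q + 0 * x - 2 * y < 0"
  shows "\<exists>n'. n = Suc n' \<and> firing p q 0 0 n' (p - x + 0 * y) y \<and> firing p q 0 0 n' x (q + 0 * x - y)"
proof -
  have "n = 0 \<and> x = 0 \<and> y = 0 \<or>
      n = 1 \<and> x = p \<and> y = 0 \<or>
      n = 1 \<and> x = 0 \<and> y = q \<or>
      n = 2 \<and> x = p \<and> y = q"
    using assms(1)
  proof (induction rule: firing.induct)
    case start
    then show ?case by simp
  next
    case (fire_x n x y)
    then show ?case
      using assms(2,3) by (elim disjE) (simp_all add: algebra_simps)
  next
    case (fire_y n x y)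
    then show ?case
      using assms(2,3) by (elim disjE) (simp_all add: algebra_simps)
  qed
  then have fin: "n = 2 \<and> x = p \<and> y = q"
    using assms(2-5) by (elim disjE) simp_all
  \<comment> \<open>The values at the last state are \<open>- p\<close> and \<open>- q\<close>
    (exchanged in type A2). Their strict negativity makes every step of the two alternating paths
    legal.\<close>
  with assms(4,5) have pq: "0 < p" "0 < q" by simp_all
  have u1: "firing p q 0 0 1 (p) (0)"
    using pq by (intro fire_x_eq[OF firing.start]) simp_all
  have v1: "firing p q 0 0 1 (0) (q)"
    using pq by (intro fire_y_eq[OF firing.start]) simp_all
  show ?thesis
    using fin u1 v1 by (intro exI[of _ 1]) (simp add: algebra_simps)
qed

lemma firing_confluent_A2:
  assumes "firing p q 1 1 n x y" "0 \<le> p" "0 \<le> q" "p - 2 * x + 1 * y < 0" "q + 1 * x - 2 * y < 0"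
  shows "\<exists>n'. n = Suc n' \<and> firing p q 1 1 n' (p - x + 1 * y) y \<and> firing p q 1 1 n' x (q + 1 * x - y)"
proof -
  have "n = 0 \<and> x = 0 \<and> y = 0 \<or>
      n = 1 \<and> x = p \<and> y = 0 \<or>
      n = 1 \<and> x = 0 \<and> y = q \<or>
      n = 2 \<and> x = p \<and> y = p + q \<or>
      n = 2 \<and> x = p + q \<and> y = q \<or>
      n = 3 \<and> x = p + q \<and> y = p + q"
    using assms(1)
  proof (induction rule: firing.induct)
    case start
    then show ?case by simp
  next
    case (fire_x n x y)
    then show ?case
      using assms(2,3) by (elim disjE) (simp_all add: algebra_simps)
  next
    case (fire_y n x y)
    then show ?case
      using assms(2,3) by (elim disjE) (simp_all add: algebra_simps)
  qed
  then have fin: "n = 3 \<and> x = p + q \<and> y = p + q"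
    using assms(2-5) by (elim disjE) simp_all
  with assms(4,5) have pq: "0 < p" "0 < q" by simp_all
  have u1: "firing p q 1 1 1 (p) (0)"
    using pq by (intro fire_x_eq[OF firing.start]) simp_all
  have u2: "firing p q 1 1 2 (p) (p + q)"
    using pq by (intro fire_y_eq[OF u1]) simp_all
  have v1: "firing p q 1 1 1 (0) (q)"
    using pq by (intro fire_y_eq[OF firing.start]) simp_all
  have v2: "firing p q 1 1 2 (p + q) (q)"
    using pq by (intro fire_x_eq[OF v1]) simp_all
  show ?thesis
    using fin u2 v2 by (intro exI[of _ 2]) (simp add: algebra_simps)
qed

lemma firing_confluent_B2:
  assumes "firing p q 1 2 n x y" "0 \<le> p" "0 \<le> q" "p - 2 * x + 1 * y < 0" "q + 2 * x - 2 * y < 0"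
  shows "\<exists>n'. n = Suc n' \<and> firing p q 1 2 n' (p - x + 1 * y) y \<and> firing p q 1 2 n' x (q + 2 * x - y)"
proof -
  have "n = 0 \<and> x = 0 \<and> y = 0 \<or>
      n = 1 \<and> x = p \<and> y = 0 \<or>
      n = 1 \<and> x = 0 \<and> y = q \<or>
      n = 2 \<and> x = p \<and> y = 2 * p + q \<or>
      n = 2 \<and> x = p + q \<and> y = q \<or>
      n = 3 \<and> x = 2 * p + q \<and> y = 2 * p + q \<or>
      n = 3 \<and> x = p + q \<and> y = 2 * p + 2 * q \<or>
      n = 4 \<and> x = 2 * p + q \<and> y = 2 * p + 2 * q"
    using assms(1)
  proof (induction rule: firing.induct)
    case start
    then show ?case by simp
  next
    case (fire_x n x y)
    then show ?case
      using assms(2,3) by (elim disjE) (simp_all add: algebra_simps)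
  next
    case (fire_y n x y)
    then show ?case
      using assms(2,3) by (elim disjE) (simp_all add: algebra_simps)
  qed
  then have fin: "n = 4 \<and> x = 2 * p + q \<and> y = 2 * p + 2 * q"
    using assms(2-5) by (elim disjE) simp_all
  with assms(4,5) have pq: "0 < p" "0 < q" by simp_all
  have u1: "firing p q 1 2 1 (p) (0)"
    using pq by (intro fire_x_eq[OF firing.start]) simp_all
  have u2: "firing p q 1 2 2 (p) (2 * p + q)"
    using pq by (intro fire_y_eq[OF u1]) simp_all
  have u3: "firing p q 1 2 3 (2 * p + q) (2 * p + q)"
    using pq by (intro fire_x_eq[OF u2]) simp_all
  have v1: "firing p q 1 2 1 (0) (q)"
    using pq by (intro fire_y_eq[OF firing.start]) simp_all
  have v2: "firing p q 1 2 2 (p + q) (q)"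
    using pq by (intro fire_x_eq[OF v1]) simp_all
  have v3: "firing p q 1 2 3 (p + q) (2 * p + 2 * q)"
    using pq by (intro fire_y_eq[OF v2]) simp_all
  show ?thesis
    using fin u3 v3 by (intro exI[of _ 3]) (simp add: algebra_simps)
qed

lemma firing_confluent_G2:
  assumes "firing p q 1 3 n x y" "0 \<le> p" "0 \<le> q" "p - 2 * x + 1 * y < 0" "q + 3 * x - 2 * y < 0"
  shows "\<exists>n'. n = Suc n' \<and> firing p q 1 3 n' (p - x + 1 * y) y \<and> firing p q 1 3 n' x (q + 3 * x - y)"
proof -
  have "n = 0 \<and> x = 0 \<and> y = 0 \<or>
      n = 1 \<and> x = p \<and> y = 0 \<or>
      n = 1 \<and> x = 0 \<and> y = q \<or>
      n = 2 \<and> x = p \<and> y = 3 * p + q \<or>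
      n = 2 \<and> x = p + q \<and> y = q \<or>
      n = 3 \<and> x = 3 * p + q \<and> y = 3 * p + q \<or>
      n = 3 \<and> x = p + q \<and> y = 3 * p + 3 * q \<or>
      n = 4 \<and> x = 3 * p + q \<and> y = 6 * p + 3 * q \<or>
      n = 4 \<and> x = 3 * p + 2 * q \<and> y = 3 * p + 3 * q \<or>
      n = 5 \<and> x = 4 * p + 2 * q \<and> y = 6 * p + 3 * q \<or>
      n = 5 \<and> x = 3 * p + 2 * q \<and> y = 6 * p + 4 * q \<or>
      n = 6 \<and> x = 4 * p + 2 * q \<and> y = 6 * p + 4 * q"
    using assms(1)
  proof (induction rule: firing.induct)
    case start
    then show ?case by simp
  next
    case (fire_x n x y)
    then show ?case
      using assms(2,3) by (elim disjE) (simp_all add: algebra_simps)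
  next
    case (fire_y n x y)
    then show ?case
      using assms(2,3) by (elim disjE) (simp_all add: algebra_simps)
  qed
  then have fin: "n = 6 \<and> x = 4 * p + 2 * q \<and> y = 6 * p + 4 * q"
    using assms(2-5) by (elim disjE) simp_all
  with assms(4,5) have pq: "0 < p" "0 < q" by simp_all
  have u1: "firing p q 1 3 1 (p) (0)"
    using pq by (intro fire_x_eq[OF firing.start]) simp_all
  have u2: "firing p q 1 3 2 (p) (3 * p + q)"
    using pq by (intro fire_y_eq[OF u1]) simp_all
  have u3: "firing p q 1 3 3 (3 * p + q) (3 * p + q)"
    using pq by (intro fire_x_eq[OF u2]) simp_all
  have u4: "firing p q 1 3 4 (3 * p + q) (6 * p + 3 * q)"
    using pq by (intro fire_y_eq[OF u3]) simp_all
  have u5: "firing p q 1 3 5 (4 * p + 2 * q) (6 * p + 3 * q)"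
    using pq by (intro fire_x_eq[OF u4]) simp_all
  have v1: "firing p q 1 3 1 (0) (q)"
    using pq by (intro fire_y_eq[OF firing.start]) simp_all
  have v2: "firing p q 1 3 2 (p + q) (q)"
    using pq by (intro fire_x_eq[OF v1]) simp_all
  have v3: "firing p q 1 3 3 (p + q) (3 * p + 3 * q)"
    using pq by (intro fire_y_eq[OF v2]) simp_all
  have v4: "firing p q 1 3 4 (3 * p + 2 * q) (3 * p + 3 * q)"
    using pq by (intro fire_x_eq[OF v3]) simp_all
  have v5: "firing p q 1 3 5 (3 * p + 2 * q) (6 * p + 4 * q)"
    using pq by (intro fire_y_eq[OF v4]) simp_all
  show ?thesis
    using fin u5 v5 by (intro exI[of _ 5]) (simp add: algebra_simps)
qed

text \<open>For \<open>4 \<le> a * b\<close> the dihedral group is infinite and has no longest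
  element, so the bottom state of the finite types has no counterpart.\<close>

lemma firing_not_both_negative:
  assumes "firing p q a b n x y" "0 \<le> p" "0 \<le> q" "0 < a" "0 < b" "4 \<le> a * b"
  shows "0 \<le> p - 2 * x + a * y \<or> 0 \<le> q + b * x - 2 * y"
proof -
  let ?u = "\<lambda>x y. p - 2 * x + a * y" and ?v = "\<lambda>x y. q + b * x - 2 * y"
  \<comment> \<open>Here \<open>c\<close> is the size of the negative value, \<open>w\<close> the
    positive value about to be fired, and \<open>d * w\<close> the amount that the negative value
    gains.\<close>
  have grow: "d * w \<le> 2 * (d * w - c)" "0 < d * w - c"
    if "c * e \<le> 2 * w" "4 \<le> d * e" "0 < c" "0 < d" for c d e w :: real
  proof -
    have "4 * c \<le> d * e * c" using that by (intro mult_right_mono) auto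
    also have "\<dots> = d * (c * e)" by simp
    also have "\<dots> \<le> d * (2 * w)" using that by (intro mult_left_mono) auto
    finally show "d * w \<le> 2 * (d * w - c)" "0 < d * w - c" using that by simp_all
  qed
  \<comment> \<open>The non-fired value stays at least \<open>a/2\<close> (resp. \<open>b/2\<close>) times the value just fired,
    and \<open>4 \<le> a * b\<close> propagates this.\<close>
  have "0 \<le> ?u x y \<and> 0 \<le> ?v x y \<or>
      ?u x y < 0 \<and> 0 < ?v x y \<and> - b * ?u x y \<le> 2 * ?v x y \<or>
      ?v x y < 0 \<and> 0 < ?u x y \<and> - a * ?v x y \<le> 2 * ?u x y"
    using assms(1)
  proof (induction rule: firing.induct)
    case start
    then show ?case using assms by simp
  next
    case (fire_x n x y)
    define t where "t = b * ?u x y"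
    have t: "0 < t" using fire_x.hyps assms by (simp add: t_def)
    have eqs: "?u (p - x + a * y) y = - ?u x y" "?v (p - x + a * y) y = ?v x y + t"
      "- b * - ?u x y = t"
      by (simp_all add: t_def algebra_simps)
    from fire_x.IH have "t \<le> 2 * (?v x y + t) \<and> 0 < ?v x y + t"
    proof (elim disjE conjE)
      assume *: "?v x y < 0" "- a * ?v x y \<le> 2 * ?u x y"
      have "- ?v x y * a \<le> 2 * ?u x y"
        using *(2) by (simp only: minus_mult_left[symmetric] mult.commute)
      from grow[OF this, of b] * assms show ?thesis
        unfolding t_def by (simp add: mult.commute add.commute)
    qed (use fire_x.hyps t in auto)
    then show ?case
      using fire_x.hyps unfolding eqs by simp
  next
    case (fire_y n x y)
    define t where "t = a * ?v x y"
    have t: "0 < t" using fire_y.hyps assms by (simp add: t_def)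
    have eqs: "?v x (q + b * x - y) = - ?v x y" "?u x (q + b * x - y) = ?u x y + t"
      "- a * - ?v x y = t"
      by (simp_all add: t_def algebra_simps)
    from fire_y.IH have "t \<le> 2 * (?u x y + t) \<and> 0 < ?u x y + t"
    proof (elim disjE conjE)
      assume *: "?u x y < 0" "- b * ?u x y \<le> 2 * ?v x y"
      have "- ?u x y * b \<le> 2 * ?v x y"
        using *(2) by (simp only: minus_mult_left[symmetric] mult.commute)
      from grow[OF this, of a] * assms show ?thesis
        unfolding t_def by (simp add: mult.commute add.commute)
    qed (use fire_y.hyps t in auto)
    then show ?case
      using fire_y.hyps unfolding eqs by simp
  qed
  then show ?thesis by linarith
qed

text \<open>The product \<open>a * b\<close> separates the types: 0 to 3 give the finite dihedral
  groups up to exchange of the nodes, and from 4 on the two sign assumptions contradict each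
  other.\<close>

lemma firing_confluent:
  fixes p q x y :: real and a b :: int
  assumes "firing p q a b n x y" "0 \<le> p" "0 \<le> q" "0 \<le> a" "0 \<le> b" "a = 0 \<longleftrightarrow> b = 0"
    "p - 2 * x + a * y < 0" "q + b * x - 2 * y < 0"
  shows "\<exists>n'. n = Suc n' \<and> firing p q a b n' (p - x + a * y) y \<and> firing p q a b n' x (q + b * x - y)"
proof -
  consider "a = 0" "b = 0" | "a = 1" "b = 1" | "a = 1" "b = 2" | "a = 1" "b = 3"
    | "a = 2" "b = 1" | "a = 3" "b = 1" | "0 < a" "0 < b" "4 \<le> a * b"
  proof -
    have "a = 0 \<or> a = 1 \<or> b = 1 \<or> 2 \<le> a \<and> 2 \<le> b"
      using assms(4-6) by linarith
    then show thesis
    proof (elim disjE)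
      assume "a = 1"
      moreover from this have "b = 1 \<or> b = 2 \<or> b = 3 \<or> 4 \<le> b"
        using assms(4-6) by auto
      ultimately show thesis using that by (elim disjE) simp_all
    next
      assume "b = 1"
      moreover from this have "a = 1 \<or> a = 2 \<or> a = 3 \<or> 4 \<le> a"
        using assms(4-6) by auto
      ultimately show thesis using that by (elim disjE) simp_all
    next
      assume "2 \<le> a \<and> 2 \<le> b"
      then show thesis using that(7) mult_mono[of 2 a 2 b] by simp
    qed (use that(1) assms(6) in simp)
  qed
  then show ?thesis
  proof cases
    case 5
    then show ?thesis
      using firing_confluent_B2[of q p n y x] assms
      by (simp add: firing_swap_iff[of p q 2 1] algebra_simps) blast
  next
    case 6
    then show ?thesis
      using firing_confluent_G2[of q p n y x] assms
      by (simp add: firing_swap_iff[of p q 3 1] algebra_simps) blast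
  next
    case 7
    then have "4 \<le> real_of_int a * real_of_int b"
      by (metis of_int_le_iff of_int_mult of_int_numeral)
    then show ?thesis using firing_not_both_negative[OF assms(1)] assms 7 by simp
  qed (use firing_confluent_A1_A1 firing_confluent_A2 firing_confluent_B2 firing_confluent_G2 assms in \<open>simp_all\<close>)
qed

section \<open>Weyl orbits of dominant weights\<close>

locale gcm_realization =
  fixes A :: "int^'n^'n"
    and \<alpha> :: "'n \<Rightarrow> ('h::euclidean_space \<Rightarrow>\<^sub>L real)"
    and \<alpha>v :: "'n \<Rightarrow> 'h"
  assumes gcm: "generalized_cartan_matrix A"
    and realization: "realization A \<alpha> \<alpha>v"
begin

abbreviation "s \<equiv> simple_reflection \<alpha> \<alpha>v"

lemma root_coroot: "blinfun_apply (\<alpha> j) (\<alpha>v i) = of_int (A $ i $ j)"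
  using realization by (simp add: realization_def)

lemma cartan_diag [simp]: "A $ i $ i = 2"
  using gcm by (simp add: generalized_cartan_matrix_def)

lemma cartan_off_diag: "i \<noteq> j \<Longrightarrow> A $ i $ j \<le> 0"
  using gcm by (simp add: generalized_cartan_matrix_def)

lemma cartan_zero_iff: "A $ i $ j = 0 \<longleftrightarrow> A $ j $ i = 0"
  using gcm by (auto simp: generalized_cartan_matrix_def)

lemma s_eq: "s i \<eta> = \<eta> - blinfun_apply \<eta> (\<alpha>v i) *\<^sub>R \<alpha> i"
  by (simp add: simple_reflection_def)

lemma s_apply: "blinfun_apply (s i \<eta>) (\<alpha>v j) = \<eta> (\<alpha>v j) - \<eta> (\<alpha>v i) * of_int (A $ j $ i)"
  by (simp add: s_eq blinfun.diff_left blinfun.scaleR_left root_coroot)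

lemma s_apply_self [simp]: "blinfun_apply (s i \<eta>) (\<alpha>v i) = - \<eta> (\<alpha>v i)"
  by (simp add: s_apply)

lemma s_s [simp]: "s i (s i \<eta>) = \<eta>"
  by (simp add: s_eq [of _ "s i \<eta>"]) (simp add: s_eq)

lemma linear_s: "linear (s i)"
  using simple_reflection_in_GL[OF gcm realization, of i] by (simp add: GL_def)

text \<open>The step count is part of the relation because \<open>descends_climb\<close> inducts on
  it and has to remove exactly one step.\<close>

inductive descends :: "'n set \<Rightarrow> ('h \<Rightarrow>\<^sub>L real) \<Rightarrow> nat \<Rightarrow> ('h \<Rightarrow>\<^sub>L real) \<Rightarrow> bool" for J \<xi> where
  refl: "descends J \<xi> 0 \<xi>"
| step: "descends J \<xi> n \<eta> \<Longrightarrow> i \<in> J \<Longrightarrow> 0 < blinfun_apply \<eta> (\<alpha>v i) \<Longrightarrow> descends J \<xi> (Suc n) (s i \<eta>)"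

lemma descends_trans:
  assumes "descends J \<eta> n \<zeta>" "descends K \<xi> m \<eta>" "J \<subseteq> K"
  shows "descends K \<xi> (m + n) \<zeta>"
  using assms(1) by induction (use assms(2,3) in \<open>auto intro: descends.intros\<close>)

text \<open>This and \<open>s_combination\<close> have the shape of the \<open>firing\<close> rules,
  so that paths in \<open>{i, j}\<close> and firing sequences translate into each other by
  rewriting.\<close>

lemma combination_apply:
  fixes \<xi> :: "'h \<Rightarrow>\<^sub>L real"
  shows "blinfun_apply (\<xi> - x *\<^sub>R \<alpha> i - y *\<^sub>R \<alpha> j) (\<alpha>v i) =
      \<xi> (\<alpha>v i) - 2 * x + of_int (- A $ i $ j) * y"
    and "blinfun_apply (\<xi> - x *\<^sub>R \<alpha> i - y *\<^sub>R \<alpha> j) (\<alpha>v j) =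
      \<xi> (\<alpha>v j) + of_int (- A $ j $ i) * x - 2 * y"
  by (simp_all add: blinfun.diff_left blinfun.scaleR_left root_coroot)

lemma s_combination:
  fixes \<xi> :: "'h \<Rightarrow>\<^sub>L real"
  shows "s i (\<xi> - x *\<^sub>R \<alpha> i - y *\<^sub>R \<alpha> j) =
      \<xi> - (\<xi> (\<alpha>v i) - x + of_int (- A $ i $ j) * y) *\<^sub>R \<alpha> i - y *\<^sub>R \<alpha> j"
    and "s j (\<xi> - x *\<^sub>R \<alpha> i - y *\<^sub>R \<alpha> j) =
      \<xi> - x *\<^sub>R \<alpha> i - (\<xi> (\<alpha>v j) + of_int (- A $ j $ i) * x - y) *\<^sub>R \<alpha> j"
proof -
  have eq: "\<xi> (\<alpha>v i) - 2 * x + of_int (- A $ i $ j) * y =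
      (\<xi> (\<alpha>v i) - x + of_int (- A $ i $ j) * y) - x"
    "\<xi> (\<alpha>v j) + of_int (- A $ j $ i) * x - 2 * y =
      (\<xi> (\<alpha>v j) + of_int (- A $ j $ i) * x - y) - y" by simp_all
  show "s i (\<xi> - x *\<^sub>R \<alpha> i - y *\<^sub>R \<alpha> j) =
      \<xi> - (\<xi> (\<alpha>v i) - x + of_int (- A $ i $ j) * y) *\<^sub>R \<alpha> i - y *\<^sub>R \<alpha> j"
    "s j (\<xi> - x *\<^sub>R \<alpha> i - y *\<^sub>R \<alpha> j) =
      \<xi> - x *\<^sub>R \<alpha> i - (\<xi> (\<alpha>v j) + of_int (- A $ j $ i) * x - y) *\<^sub>R \<alpha> j"
    unfolding s_eq combination_apply eq scaleR_diff_left[of _ x] scaleR_diff_left[of _ y] by simp_all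
qed

lemma descends_imp_firing:
  assumes "descends {i, j} \<xi> n \<nu>"
  shows "\<exists>x y. \<nu> = \<xi> - x *\<^sub>R \<alpha> i - y *\<^sub>R \<alpha> j \<and>
    firing (\<xi> (\<alpha>v i)) (\<xi> (\<alpha>v j)) (of_int (- A $ i $ j)) (of_int (- A $ j $ i)) n x y"
  using assms
proof induction
  case refl
  then show ?case by (intro exI[of _ 0]) (simp add: firing.start)
next
  case (step n \<eta> k)
  then obtain x y where \<eta>: "\<eta> = \<xi> - x *\<^sub>R \<alpha> i - y *\<^sub>R \<alpha> j"
    and f: "firing (\<xi> (\<alpha>v i)) (\<xi> (\<alpha>v j)) (of_int (- A $ i $ j)) (of_int (- A $ j $ i)) n x y"
    by blast
  from step.hyps(2) consider "k = i" | "k = j" by blast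
  then show ?case
  proof cases
    case 1
    then show ?thesis
      using firing.fire_x[OF f] step.hyps(3) unfolding \<eta> 1 combination_apply s_combination by blast
  next
    case 2
    then show ?thesis
      using firing.fire_y[OF f] step.hyps(3) unfolding \<eta> 2 combination_apply s_combination by blast
  qed
qed

lemma firing_imp_descends:
  fixes \<xi> :: "'h \<Rightarrow>\<^sub>L real"
  assumes "firing (\<xi> (\<alpha>v i)) (\<xi> (\<alpha>v j)) (of_int (- A $ i $ j)) (of_int (- A $ j $ i)) n x y"
  shows "descends {i, j} \<xi> n (\<xi> - x *\<^sub>R \<alpha> i - y *\<^sub>R \<alpha> j)"
  using assms
proof induction
  case start
  then show ?case by (simp add: descends.refl)
next
  case (fire_x n x y)
  then show ?case
    using descends.step[OF fire_x.IH, of i] unfolding combination_apply s_combination by blast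
next
  case (fire_y n x y)
  then show ?case
    using descends.step[OF fire_y.IH, of j] unfolding combination_apply s_combination by blast
qed

text \<open>At a weight negative at both coroots the last reflection of a rank 2 path can be chosen
  freely; here confluence selects \<open>i\<close>.\<close>

lemma descends_rank_2:
  assumes "descends {i, j} \<xi> n \<nu>" "i \<noteq> j" "0 \<le> blinfun_apply \<xi> (\<alpha>v i)" "0 \<le> blinfun_apply \<xi> (\<alpha>v j)"
    and neg: "blinfun_apply \<nu> (\<alpha>v i) < 0" "blinfun_apply \<nu> (\<alpha>v j) < 0"
  shows "\<exists>n'. n = Suc n' \<and> descends {i, j} \<xi> n' (s i \<nu>)"
proof -
  obtain x y where \<nu>: "\<nu> = \<xi> - x *\<^sub>R \<alpha> i - y *\<^sub>R \<alpha> j"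
    and f: "firing (\<xi> (\<alpha>v i)) (\<xi> (\<alpha>v j)) (of_int (- A $ i $ j)) (of_int (- A $ j $ i)) n x y"
    using descends_imp_firing[OF assms(1)] by blast
  obtain n' where "n = Suc n'"
    "firing (\<xi> (\<alpha>v i)) (\<xi> (\<alpha>v j)) (of_int (- A $ i $ j)) (of_int (- A $ j $ i)) n'
      (\<xi> (\<alpha>v i) - x + of_int (- A $ i $ j) * y) y"
    using firing_confluent[OF f] assms(2-) cartan_off_diag[of i j] cartan_off_diag[of j i]
      cartan_zero_iff[of i j] unfolding \<nu> combination_apply by auto
  then show ?thesis
    unfolding \<nu> s_combination by (blast intro: firing_imp_descends)
qed

text \<open>
  If \<open>\<nu>\<close> was reached by a last step \<open>j \<noteq> i\<close>, climb back inside the rank 2 subsystem \<open>{i, j}\<close> to a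
  \<open>{i, j}\<close>-dominant weight; this is possible by the induction hypothesis.  The rank 2 analysis
  then yields a path that ends with \<open>i\<close> instead.
\<close>

lemma descends_climb:
  assumes "\<mu> \<in> fundamental_chamber \<alpha>v" "descends UNIV \<mu> n \<nu>" "blinfun_apply \<nu> (\<alpha>v i) < 0"
  shows "\<exists>n'. n = Suc n' \<and> descends UNIV \<mu> n' (s i \<nu>)"
proof -
  have dominant: "0 \<le> blinfun_apply \<mu> (\<alpha>v k)" for k
    using assms(1) by (simp add: fundamental_chamber_def)
  show ?thesis
    using assms(2,3)
  proof (induction n arbitrary: \<nu> i rule: less_induct)
    case (less n)
    from less.prems(1) show ?case
    proof cases
      case refl
      then show ?thesis using less.prems(2) dominant[of i] by simp
    next
      case (step m \<eta> j)
      show ?thesis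
      proof (cases "i = j")
        case True
        then show ?thesis using step by simp
      next
        case False
        \<comment> \<open>Every weight reached in fewer than \<open>n\<close> steps factors through
          an \<open>{i, j}\<close>-dominant one. The outer hypothesis supplies each climb, and the
          exact sum \<open>k + l\<close> ensures that rerouting does not change the length.\<close>
        have "\<exists>\<xi> k l. m' = k + l \<and> descends UNIV \<mu> k \<xi> \<and> descends {i, j} \<xi> l \<zeta> \<and>
            0 \<le> blinfun_apply \<xi> (\<alpha>v i) \<and> 0 \<le> blinfun_apply \<xi> (\<alpha>v j)"
          if "descends UNIV \<mu> m' \<zeta>" "m' < n" for m' \<zeta>
          using that
        proof (induction m' arbitrary: \<zeta>)
          case (0 \<zeta>)
          then have "\<zeta> = \<mu>" by (auto elim: descends.cases)
          then show ?case
            using dominant descends.refl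
            by (intro exI[of _ \<mu>] exI[of _ 0]) simp
        next
          case (Suc m' \<zeta>)
          show ?case
          proof (cases "0 \<le> blinfun_apply \<zeta> (\<alpha>v i) \<and> 0 \<le> blinfun_apply \<zeta> (\<alpha>v j)")
            case True
            then show ?thesis
              using Suc.prems(1) descends.refl
            by (intro exI[of _ \<zeta>] exI[of _ "Suc m'"] exI[of _ 0]) simp
          next
            case False
            then obtain k where k: "k \<in> {i, j}" "blinfun_apply \<zeta> (\<alpha>v k) < 0" by force
            with less.IH[OF Suc.prems(2,1)] have "descends UNIV \<mu> m' (s k \<zeta>)" by auto
            from Suc.IH[OF this] Suc.prems obtain \<xi> p l where *: "m' = p + l"
              "descends UNIV \<mu> p \<xi>" "descends {i, j} \<xi> l (s k \<zeta>)"
              "0 \<le> blinfun_apply \<xi> (\<alpha>v i)" "0 \<le> blinfun_apply \<xi> (\<alpha>v j)" by auto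
            then have "descends {i, j} \<xi> (Suc l) \<zeta>"
              using descends.step[OF *(3) k(1)] k(2) by simp
            with * show ?thesis by (intro exI[of _ \<xi>] exI[of _ p] exI[of _ "Suc l"]) simp
          qed
        qed
        from this[OF step(3)] obtain \<xi> k l where *: "m = k + l" "descends UNIV \<mu> k \<xi>"
          "descends {i, j} \<xi> l \<eta>" "0 \<le> blinfun_apply \<xi> (\<alpha>v i)" "0 \<le> blinfun_apply \<xi> (\<alpha>v j)"
          using step(1) by auto
        have "descends {i, j} \<xi> (Suc l) \<nu>"
          using descends.step[OF *(3), of j] step(2,5) by simp
        moreover have "blinfun_apply \<nu> (\<alpha>v j) < 0"
          using step(2,5) by simp
        ultimately have "descends {i, j} \<xi> l (s i \<nu>)"
          using descends_rank_2[of i j \<xi> "Suc l" \<nu>] *(4,5) False less.prems(2) by simp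
        from descends_trans[OF this *(2)] show ?thesis using step(1) *(1) by simp
      qed
    qed
    qed
qed

section \<open>Parabolic subgroups and their orbits\<close>

lemma s_in_weyl_subgroup: "i \<in> I \<Longrightarrow> s i \<in> weyl_subgroup \<alpha> \<alpha>v I"
  by (simp add: weyl_subgroup_def generate.incl)

lemma id_in_weyl_subgroup: "id \<in> weyl_subgroup \<alpha> \<alpha>v I"
  using generate.one[of GL] by (simp add: weyl_subgroup_def GL_def)

lemma weyl_subgroup_comp:
  "v \<in> weyl_subgroup \<alpha> \<alpha>v I \<Longrightarrow> w \<in> weyl_subgroup \<alpha> \<alpha>v I \<Longrightarrow> v \<circ> w \<in> weyl_subgroup \<alpha> \<alpha>v I"
  using generate.eng[of v GL _ w] by (simp add: weyl_subgroup_def GL_def)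

lemma weyl_subgroup_mono: "I \<subseteq> J \<Longrightarrow> weyl_subgroup \<alpha> \<alpha>v I \<subseteq> weyl_subgroup \<alpha> \<alpha>v J"
  unfolding weyl_subgroup_def by (intro group.mono_generate group_GL) auto

text \<open>Simple reflections are their own inverses, so left multiplication by them exhausts the
  group. The stronger claim \<open>P v \<longrightarrow> P (w \<circ> v)\<close> is what passes
  through products.\<close>

lemma weyl_subgroup_induct [consumes 1, case_names id step]:
  assumes "w \<in> weyl_subgroup \<alpha> \<alpha>v I" "P id" "\<And>i w. i \<in> I \<Longrightarrow> P w \<Longrightarrow> P (s i \<circ> w)"
  shows "P w"
proof -
  have "\<forall>v. P v \<longrightarrow> P (w \<circ> v)"
    using assms(1) unfolding weyl_subgroup_def
  proof induction
    case one
    then show ?case by (simp add: GL_def)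
  next
    case (incl h)
    then obtain i where "i \<in> I" "h = s i" by auto
    with assms(3) show ?case by blast
  next
    case (inv h)
    then obtain i where i: "i \<in> I" "h = s i" by auto
    have "inv\<^bsub>GL\<^esub> h = s i"
      using simple_reflection_in_GL[OF gcm realization, of i]
      by (intro group.inv_equality[OF group_GL]) (auto simp: i GL_def)
    with i(1) assms(3) show ?case by metis
  next
    case (eng v w)
    then show ?case by (simp add: GL_def comp_assoc)
  qed
  with assms(2) show ?thesis by force
qed

lemma weyl_subgroup_stable:
  assumes "w \<in> weyl_subgroup \<alpha> \<alpha>v I" "x \<in> S" "\<And>i x. i \<in> I \<Longrightarrow> x \<in> S \<Longrightarrow> s i x \<in> S"
  shows "w x \<in> S"
  using assms(1) by (induction rule: weyl_subgroup_induct) (use assms in auto)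

lemma base_in_weyl_orbit: "\<mu> \<in> weyl_orbit \<alpha> \<alpha>v I \<mu>"
  unfolding weyl_orbit_def by (rule image_eqI[OF _ id_in_weyl_subgroup]) simp

lemma s_in_weyl_orbit:
  assumes "i \<in> I" "x \<in> weyl_orbit \<alpha> \<alpha>v I \<mu>"
  shows "s i x \<in> weyl_orbit \<alpha> \<alpha>v I \<mu>"
proof -
  obtain w where "w \<in> weyl_subgroup \<alpha> \<alpha>v I" "x = w \<mu>"
    using assms(2) by (auto simp: weyl_orbit_def)
  with weyl_subgroup_comp[OF s_in_weyl_subgroup[OF assms(1)]] show ?thesis
    unfolding weyl_orbit_def by (metis comp_apply image_eqI)
qed

lemma weyl_orbit_subset:
  assumes "\<mu> \<in> S" "\<And>i x. i \<in> I \<Longrightarrow> x \<in> S \<Longrightarrow> s i x \<in> S"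
  shows "weyl_orbit \<alpha> \<alpha>v I \<mu> \<subseteq> S"
  using weyl_subgroup_stable assms unfolding weyl_orbit_def by blast

text \<open>A reflection at a positive value extends the path, at value 0 it fixes the weight, and
  at a negative value \<open>descends_climb\<close> shortens the path.\<close>

lemma weyl_orbit_descends:
  assumes "\<mu> \<in> fundamental_chamber \<alpha>v" "x \<in> weyl_orbit \<alpha> \<alpha>v UNIV \<mu>"
  shows "\<exists>n. descends UNIV \<mu> n x"
proof -
  have "weyl_orbit \<alpha> \<alpha>v UNIV \<mu> \<subseteq> {x. \<exists>n. descends UNIV \<mu> n x}"
  proof (rule weyl_orbit_subset)
    fix i x assume "x \<in> {x. \<exists>n. descends UNIV \<mu> n x}"
    then obtain n where n: "descends UNIV \<mu> n x" by blast
    consider "0 < blinfun_apply x (\<alpha>v i)" | "blinfun_apply x (\<alpha>v i) = 0"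
      | "blinfun_apply x (\<alpha>v i) < 0" by linarith
    then show "s i x \<in> {x. \<exists>n. descends UNIV \<mu> n x}"
    proof cases
      case 1
      then show ?thesis using descends.step[OF n] by blast
    next
      case 2
      then have "s i x = x" by (simp add: s_eq)
      with n show ?thesis by auto
    next
      case 3
      from descends_climb[OF assms(1) n this] show ?thesis by blast
    qed
  qed (use descends.refl in blast)
  then show ?thesis using assms(2) by blast
qed

end

section \<open>Convexity and cones\<close>

text \<open>A generator 0 contributes nothing, and a positive generator \<open>g k\<close> can occur
  at most \<open>b / g k\<close> times. This provides termination in
  \<open>hull_to_chamber\<close>.\<close>

lemma finite_nat_combinations_le:
  fixes g :: "'k \<Rightarrow> real"
  assumes "finite K" "\<And>k. k \<in> K \<Longrightarrow> 0 \<le> g k"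
  shows "finite {x. (\<exists>n :: 'k \<Rightarrow> nat. x = (\<Sum>k\<in>K. of_nat (n k) * g k)) \<and> x \<le> b}"
  using assms
proof (induction K rule: finite_induct)
  case empty
  show ?case by (rule finite_subset[of _ "{0}"]) auto
next
  case (insert k K)
  let ?S = "\<lambda>K. {x. (\<exists>n :: 'k \<Rightarrow> nat. x = (\<Sum>k\<in>K. of_nat (n k) * g k)) \<and> x \<le> b}"
  show ?case
  proof (cases "g k = 0")
    case True
    then have "?S (insert k K) = ?S K" using insert.hyps by simp
    then show ?thesis using insert by simp
  next
    case False
    with insert.prems have pos: "0 < g k" by (simp add: order_less_le)
    have "?S (insert k K) \<subseteq> (\<Union>m \<le> nat \<lceil>b / g k\<rceil>. (\<lambda>x. of_nat m * g k + x) ` ?S K)"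
    proof
      fix x assume "x \<in> ?S (insert k K)"
      then obtain n :: "'k \<Rightarrow> nat" where x: "x = (\<Sum>k\<in>insert k K. of_nat (n k) * g k)" "x \<le> b"
        by blast
      let ?y = "\<Sum>k\<in>K. of_nat (n k) * g k"
      have x': "x = of_nat (n k) * g k + ?y" using x(1) insert.hyps by simp
      have y: "0 \<le> ?y" using insert.prems by (intro sum_nonneg) auto
      have "of_nat (n k) * g k \<le> b" using x(2) x' y by linarith
      then have "of_nat (n k) \<le> b / g k" using pos by (simp add: field_simps)
      then have "n k \<le> nat \<lceil>b / g k\<rceil>" by linarith
      moreover have "?y \<le> b" using x(2) x' pos by (smt (verit) mult_nonneg_nonneg of_nat_0_le_iff)
      ultimately show "x \<in> (\<Union>m \<le> nat \<lceil>b / g k\<rceil>. (\<lambda>x. of_nat m * g k + x) ` ?S K)"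
        using x' by blast
    qed
    then show ?thesis using insert by (elim finite_subset) auto
  qed
qed

text \<open>A pair of mutually inverse maps covers both the Riesz isomorphism and the simple
  reflections, which are inverse to themselves.\<close>

lemma rel_interior_linear_homeomorphism:
  fixes f :: "'a::real_normed_vector \<Rightarrow> 'b::real_normed_vector"
  assumes "bounded_linear f" "bounded_linear g" "\<And>x. g (f x) = x" "\<And>y. f (g y) = y"
    and "x \<in> rel_interior S"
  shows "f x \<in> rel_interior (f ` S)"
proof -
  obtain T where T: "open T" "x \<in> T \<inter> S" "T \<inter> affine hull S \<subseteq> S"
    using assms(5) by (auto simp: mem_rel_interior)
  have "open (g -` T)"
    by (rule open_vimage[OF T(1) linear_continuous_on[OF assms(2)]])
  moreover have "g -` T \<inter> affine hull (f ` S) \<subseteq> f ` S"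
    using T(3) assms(3) unfolding affine_hull_linear_image[OF assms(1), symmetric] by auto
  ultimately show ?thesis
    using T(2) assms(3) unfolding mem_rel_interior by (intro exI[of _ "g -` T"]) auto
qed

text \<open>
  The library's \<open>rel_interior_eq_empty\<close> needs the class \<open>euclidean_space\<close>, to which the dual space
  does not belong; the Riesz isomorphism transfers it.
\<close>

lemma rel_interior_dual_nonempty:
  fixes S :: "('h::euclidean_space \<Rightarrow>\<^sub>L real) set"
  assumes "convex S" "S \<noteq> {}"
  shows "rel_interior S \<noteq> {}"
proof -
  define g :: "('h \<Rightarrow>\<^sub>L real) \<Rightarrow> 'h" where "g \<eta> = (\<Sum>b\<in>Basis. \<eta> b *\<^sub>R b)" for \<eta>
  have g: "bounded_linear g"
    unfolding g_def by (intro bounded_linear_sum bounded_linear_scaleR_left[THEN bounded_linear_compose]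
        bounded_linear_intros)
  have fg: "blinfun_inner_left (g \<eta>) = \<eta>" for \<eta>
  proof (rule blinfun_eqI)
    fix h
    have "blinfun_apply \<eta> h = blinfun_apply \<eta> (\<Sum>b\<in>Basis. (h \<bullet> b) *\<^sub>R b)"
      by (simp add: euclidean_representation)
    also have "\<dots> = (\<Sum>b\<in>Basis. (h \<bullet> b) * \<eta> b)"
      by (simp add: blinfun.sum_right blinfun.scaleR_right)
    finally show "blinfun_apply (blinfun_inner_left (g \<eta>)) h = \<eta> h"
      by (simp add: g_def inner_sum_right mult.commute)
  qed
  have gf: "g (blinfun_inner_left v) = v" for v
    by (simp add: g_def inner_commute[of _ v] euclidean_representation)
  have "convex (g ` S)" "g ` S \<noteq> {}"
    using assms convex_linear_image[OF bounded_linear.linear[OF g]] by auto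
  then obtain x where "x \<in> rel_interior (g ` S)"
    using rel_interior_eq_empty by blast
  from rel_interior_linear_homeomorphism[OF bounded_linear_blinfun_inner_left g gf fg this]
  show ?thesis by (auto simp: image_image fg)
qed

text \<open>If an inner point of a segment has value \<open>c\<close>, the deficits of the endpoints
  are nonnegative with a positive combination equal to 0, hence both vanish.\<close>

lemma face_of_maximizers:
  fixes H :: "'a::real_vector set" and \<phi> :: "'a \<Rightarrow> real"
  assumes "linear \<phi>" "convex H" "\<And>x. x \<in> H \<Longrightarrow> \<phi> x \<le> c"
  shows "{x \<in> H. \<phi> x = c} face_of H"
  unfolding face_of_def
proof (intro conjI ballI impI)
  interpret linear \<phi> by fact
  have "{x \<in> H. \<phi> x = c} = H \<inter> \<phi> -` {c}" by auto
  then show "convex {x \<in> H. \<phi> x = c}"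
    using assms(2) convex_linear_vimage[OF assms(1), of "{c}"] by (simp add: convex_Int)
  fix a b x
  assume ab: "a \<in> H" "b \<in> H" and x: "x \<in> {x \<in> H. \<phi> x = c}" "x \<in> open_segment a b"
  obtain u where u: "0 < u" "u < 1" "x = (1 - u) *\<^sub>R a + u *\<^sub>R b"
    using x(2) by (auto simp: in_segment)
  have c: "c = (1 - u) * \<phi> a + u * \<phi> b"
    using x(1) u(3) by (simp add: add scale)
  have "\<phi> a = c \<and> \<phi> b = c"
  proof -
    have "(1 - u) * (c - \<phi> a) + u * (c - \<phi> b) = 0" using c by (simp add: algebra_simps)
    moreover have "0 \<le> (1 - u) * (c - \<phi> a)" "0 \<le> u * (c - \<phi> b)"
      using u assms(3) ab by simp_all
    ultimately have "(1 - u) * (c - \<phi> a) = 0" "u * (c - \<phi> b) = 0" by linarith+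
    then show ?thesis using u by simp
  qed
  then show "a \<in> {x \<in> H. \<phi> x = c}" "b \<in> {x \<in> H. \<phi> x = c}" using ab by auto
qed auto

section \<open>Cones spanned by simple roots\<close>

lemma nonneg_spanI: "(\<And>i. i \<in> I \<Longrightarrow> 0 \<le> c i) \<Longrightarrow> (\<Sum>i\<in>I. c i *\<^sub>R \<alpha> i) \<in> nonneg_span \<alpha> I"
  by (auto simp: nonneg_span_def)

lemma nonneg_spanE:
  assumes "\<beta> \<in> nonneg_span \<alpha> I"
  obtains c where "\<beta> = (\<Sum>i\<in>I. c i *\<^sub>R \<alpha> i)" "\<And>i. i \<in> I \<Longrightarrow> 0 \<le> c i"
  using assms by (auto simp: nonneg_span_def)

lemma zero_in_nonneg_span: "0 \<in> nonneg_span \<alpha> I"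
  using nonneg_spanI[of I "\<lambda>_. 0" \<alpha>] by simp

lemma nonneg_span_add:
  assumes "\<beta> \<in> nonneg_span \<alpha> I" "\<gamma> \<in> nonneg_span \<alpha> I"
  shows "\<beta> + \<gamma> \<in> nonneg_span \<alpha> I"
proof -
  obtain c d where "\<beta> = (\<Sum>i\<in>I. c i *\<^sub>R \<alpha> i)" "\<And>i. i \<in> I \<Longrightarrow> 0 \<le> c i"
    "\<gamma> = (\<Sum>i\<in>I. d i *\<^sub>R \<alpha> i)" "\<And>i. i \<in> I \<Longrightarrow> 0 \<le> d i"
    using assms unfolding nonneg_span_def by blast
  then show ?thesis
    using nonneg_spanI[of I "\<lambda>i. c i + d i" \<alpha>] by (simp add: scaleR_add_left sum.distrib)
qed

lemma nonneg_span_scale: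
  assumes "\<beta> \<in> nonneg_span \<alpha> I" "0 \<le> t"
  shows "t *\<^sub>R \<beta> \<in> nonneg_span \<alpha> I"
proof -
  obtain c where "\<beta> = (\<Sum>i\<in>I. c i *\<^sub>R \<alpha> i)" "\<And>i. i \<in> I \<Longrightarrow> 0 \<le> c i"
    using assms(1) unfolding nonneg_span_def by blast
  then show ?thesis
    using nonneg_spanI[of I "\<lambda>i. t * c i" \<alpha>] assms(2) by (simp add: scaleR_sum_right)
qed

lemma generator_in_nonneg_span: "i \<in> I \<Longrightarrow> \<alpha> i \<in> nonneg_span \<alpha> I"
  using nonneg_spanI[of I "\<lambda>j. if j = i then 1 else 0" \<alpha>]
  by (simp add: if_distrib[of "\<lambda>c. c *\<^sub>R _"] cong: if_cong)

lemma nonneg_span_subset_span: "nonneg_span \<alpha> I \<subseteq> span (\<alpha> ` I)"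
  by (clarsimp simp: nonneg_span_def) (intro span_sum span_scale span_base imageI)

lemma convex_diff_nonneg_span: "convex {x. \<mu> - x \<in> nonneg_span \<alpha> I}"
proof (rule convexI)
  fix x y and u v :: real
  assume xy: "x \<in> {x. \<mu> - x \<in> nonneg_span \<alpha> I}" "y \<in> {x. \<mu> - x \<in> nonneg_span \<alpha> I}"
    and uv: "0 \<le> u" "0 \<le> v" "u + v = 1"
  have "\<mu> - (u *\<^sub>R x + v *\<^sub>R y) = (u + v) *\<^sub>R \<mu> - (u *\<^sub>R x + v *\<^sub>R y)" by (simp add: uv(3))
  also have "\<dots> = u *\<^sub>R (\<mu> - x) + v *\<^sub>R (\<mu> - y)" by (simp add: algebra_simps)
  finally show "u *\<^sub>R x + v *\<^sub>R y \<in> {x. \<mu> - x \<in> nonneg_span \<alpha> I}"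
    using xy uv by (auto intro: nonneg_span_add nonneg_span_scale)
qed

section \<open>Faces spanned by parabolic orbits\<close>

context gcm_realization
begin

text \<open>Independence of the simple roots yields coordinate functionals, the height, and the
  functional exposing the face.\<close>

lemma ex_functional: "\<exists>\<phi>. linear \<phi> \<and> (\<forall>i. \<phi> (\<alpha> i) = (f i :: real))"
proof -
  have "inj \<alpha>" "independent (range \<alpha>)" using realization by (auto simp: realization_def)
  then show ?thesis
    using linear_independent_extend[of "range \<alpha>" "\<lambda>x. f (inv_into UNIV \<alpha> x)"] by auto
qed

text \<open>Independence of the simple coroots yields the fundamental weights.\<close>

lemma ex_weight: "\<exists>\<omega> :: 'h \<Rightarrow>\<^sub>L real. \<forall>i. \<omega> (\<alpha>v i) = f i"
proof -
  have "inj \<alpha>v" "independent (range \<alpha>v)" using realization by (auto simp: realization_def)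
  then obtain g :: "'h \<Rightarrow> real" where "linear g" "\<forall>i. g (\<alpha>v i) = f i"
    using linear_independent_extend[of "range \<alpha>v" "\<lambda>x. f (inv_into UNIV \<alpha>v x)"] by auto
  then show ?thesis
    by (intro exI[of _ "Blinfun g"]) (simp add: bounded_linear_Blinfun_apply linear_conv_bounded_linear)
qed

lemma descends_below: "descends J \<xi> n \<nu> \<Longrightarrow> \<xi> - \<nu> \<in> nonneg_span \<alpha> J"
proof (induction rule: descends.induct)
  case refl
  then show ?case by (simp add: zero_in_nonneg_span)
next
  case (step n \<eta> i)
  then have "\<xi> - \<eta> + \<eta> (\<alpha>v i) *\<^sub>R \<alpha> i \<in> nonneg_span \<alpha> J"
    by (intro nonneg_span_add nonneg_span_scale generator_in_nonneg_span) auto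
  then show ?case by (simp add: s_eq algebra_simps)
qed

text \<open>The coordinate functional of a root outside \<open>I\<close> vanishes on the span of
  \<open>I\<close>, which kills that coefficient.\<close>

lemma nonneg_span_restrict:
  assumes "\<beta> \<in> nonneg_span \<alpha> UNIV" "\<beta> \<in> span (\<alpha> ` I)"
  shows "\<beta> \<in> nonneg_span \<alpha> I"
proof -
  obtain c where c: "\<beta> = (\<Sum>i\<in>UNIV. c i *\<^sub>R \<alpha> i)" "\<And>i. 0 \<le> c i"
    using assms(1) unfolding nonneg_span_def by blast
  have "c i = 0" if "i \<notin> I" for i
  proof -
    obtain \<phi> where \<phi>: "linear \<phi>" "\<And>j. \<phi> (\<alpha> j) = (if j = i then 1 else 0 :: real)"
      using ex_functional[of "\<lambda>j. if j = i then 1 else 0"] by blast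
    have "\<phi> \<beta> = 0"
      using linear_eq_0_on_span[OF \<phi>(1) _ assms(2)] \<phi>(2) that by fastforce
    moreover have "\<phi> \<beta> = (\<Sum>j\<in>UNIV. c j * (if j = i then 1 else 0))"
      unfolding c(1) linear_sum[OF \<phi>(1)] linear_scale[OF \<phi>(1)] \<phi>(2) by simp
    moreover have "\<dots> = c i" by (simp add: if_distrib[of "\<lambda>t. _ * t"] cong: if_cong)
    ultimately show ?thesis by simp
  qed
  then have "\<beta> = (\<Sum>i\<in>I. c i *\<^sub>R \<alpha> i)"
    unfolding c(1) by (intro sum.mono_neutral_right) auto
  then show ?thesis using nonneg_spanI[of I c] c(2) by simp
qed

lemma weyl_orbit_diff_span: "x \<in> weyl_orbit \<alpha> \<alpha>v I \<mu> \<Longrightarrow> \<mu> - x \<in> span (\<alpha> ` I)"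
proof -
  have "weyl_orbit \<alpha> \<alpha>v I \<mu> \<subseteq> {x. \<mu> - x \<in> span (\<alpha> ` I)}"
  proof (rule weyl_orbit_subset)
    fix i x assume "i \<in> I" "x \<in> {x. \<mu> - x \<in> span (\<alpha> ` I)}"
    then have "\<mu> - x + x (\<alpha>v i) *\<^sub>R \<alpha> i \<in> span (\<alpha> ` I)"
      by (auto intro: span_add span_scale span_base)
    then show "s i x \<in> {x. \<mu> - x \<in> span (\<alpha> ` I)}" by (simp add: s_eq algebra_simps)
  qed (simp add: span_zero)
  then show "x \<in> weyl_orbit \<alpha> \<alpha>v I \<mu> \<Longrightarrow> ?thesis" by auto
qed

lemma weyl_orbit_mono: "I \<subseteq> J \<Longrightarrow> weyl_orbit \<alpha> \<alpha>v I \<mu> \<subseteq> weyl_orbit \<alpha> \<alpha>v J \<mu>"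
  unfolding weyl_orbit_def by (intro image_mono weyl_subgroup_mono)

text \<open>Paths in the full group give nonnegative coefficients, and membership in the span
  confines them to \<open>I\<close>.\<close>

lemma weyl_orbit_below:
  assumes "\<mu> \<in> fundamental_chamber \<alpha>v" "x \<in> weyl_orbit \<alpha> \<alpha>v I \<mu>"
  shows "\<mu> - x \<in> nonneg_span \<alpha> I"
proof (rule nonneg_span_restrict)
  have "x \<in> weyl_orbit \<alpha> \<alpha>v UNIV \<mu>" using weyl_orbit_mono assms(2) by blast
  then show "\<mu> - x \<in> nonneg_span \<alpha> UNIV"
    using weyl_orbit_descends[OF assms(1)] descends_below by blast
qed (rule weyl_orbit_diff_span[OF assms(2)])

text \<open>Off-diagonal Cartan entries are nonpositive, so subtracting roots from \<open>I\<close>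
  can only raise the value at a coroot outside \<open>I\<close>.\<close>

lemma below_dominant:
  assumes "\<mu> \<in> fundamental_chamber \<alpha>v" "\<mu> - x \<in> nonneg_span \<alpha> I" "i \<notin> I"
  shows "0 \<le> blinfun_apply x (\<alpha>v i)"
proof -
  obtain c where c: "\<mu> - x = (\<Sum>j\<in>I. c j *\<^sub>R \<alpha> j)" "\<And>j. j \<in> I \<Longrightarrow> 0 \<le> c j"
    using assms(2) by (auto elim: nonneg_spanE)
  have "blinfun_apply (\<mu> - x) (\<alpha>v i) = (\<Sum>j\<in>I. c j * of_int (A $ i $ j))"
    unfolding c(1) by (simp add: blinfun.sum_left blinfun.scaleR_left root_coroot)
  also have "\<dots> \<le> 0"
  proof (intro sum_nonpos mult_nonneg_nonpos)
    fix j assume "j \<in> I"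
    with assms(3) cartan_off_diag[of i j] show "real_of_int (A $ i $ j) \<le> 0" by auto
  qed (rule c(2))
  finally show ?thesis
    using assms(1) by (simp add: blinfun.diff_left fundamental_chamber_def) (meson order_trans)
qed

lemma descends_in_weyl_orbit:
  assumes "\<mu> \<in> fundamental_chamber \<alpha>v" "descends UNIV \<mu> n y" "\<mu> - y \<in> nonneg_span \<alpha> I"
  shows "y \<in> weyl_orbit \<alpha> \<alpha>v I \<mu>"
  using assms(2,3)
proof (induction rule: descends.induct)
  case refl
  show ?case by (rule base_in_weyl_orbit)
next
  case (step n \<eta> i)
  \<comment> \<open>The step leaves a negative value at its own coroot, which
    \<open>below_dominant\<close> excludes outside \<open>I\<close>.\<close>
  have "i \<in> I"
    using below_dominant[OF assms(1) step.prems, of i] step.hyps by auto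
  moreover have "\<mu> - \<eta> \<in> nonneg_span \<alpha> I"
  proof (rule nonneg_span_restrict)
    show "\<mu> - \<eta> \<in> nonneg_span \<alpha> UNIV" by (rule descends_below) fact
    have *: "\<mu> - s i \<eta> \<in> span (\<alpha> ` I)"
      using step.prems nonneg_span_subset_span by blast
    have "(\<mu> - s i \<eta>) - \<eta> (\<alpha>v i) *\<^sub>R \<alpha> i \<in> span (\<alpha> ` I)"
      using \<open>i \<in> I\<close> by (intro span_diff[OF *] span_scale span_base imageI)
    then show "\<mu> - \<eta> \<in> span (\<alpha> ` I)" by (simp add: s_eq)
  qed
  ultimately show ?case using step.IH s_in_weyl_orbit by blast
qed

lemma weyl_orbit_Int_below:
  assumes "\<mu> \<in> fundamental_chamber \<alpha>v" "y \<in> weyl_orbit \<alpha> \<alpha>v UNIV \<mu>" "\<mu> - y \<in> nonneg_span \<alpha> I"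
  shows "y \<in> weyl_orbit \<alpha> \<alpha>v I \<mu>"
  using weyl_orbit_descends[OF assms(1,2)] descends_in_weyl_orbit[OF assms(1)] assms(3) by blast

section \<open>Integrality of heights\<close>

lemma linear_coroot: "linear (\<lambda>\<eta> :: 'h \<Rightarrow>\<^sub>L real. blinfun_apply \<eta> h)"
  by (rule linearI) (simp_all add: blinfun.add_left blinfun.scaleR_left)

text \<open>The functional is arbitrary because the induction step for one \<phi> needs the
  hypothesis for a coroot as well, whose values on the roots are Cartan entries. The coefficients do
  not depend on \<eta>.\<close>

lemma weyl_subgroup_int_coefficients:
  assumes "w \<in> weyl_subgroup \<alpha> \<alpha>v I" "linear \<phi>" "\<And>i. \<phi> (\<alpha> i) = of_int (k i)"
  shows "\<exists>n :: 'n \<Rightarrow> int. \<forall>\<eta>. \<phi> (\<eta> - w \<eta>) = (\<Sum>j\<in>UNIV. of_int (n j) * blinfun_apply \<eta> (\<alpha>v j))"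
  using assms
proof (induction arbitrary: \<phi> k rule: weyl_subgroup_induct)
  case id
  then show ?case by (intro exI[of _ "\<lambda>_. 0"]) (simp add: linear_0)
next
  case (step i w)
  obtain n where n: "\<And>\<eta>. \<phi> (\<eta> - w \<eta>) = (\<Sum>j\<in>UNIV. of_int (n j) * blinfun_apply \<eta> (\<alpha>v j))"
    using step.IH[OF step.prems] by blast
  obtain m where m: "\<And>\<eta>. blinfun_apply (\<eta> - w \<eta>) (\<alpha>v i) = (\<Sum>j\<in>UNIV. of_int (m j) * blinfun_apply \<eta> (\<alpha>v j))"
    using step.IH[OF linear_coroot[of "\<alpha>v i"], of "\<lambda>j. A $ i $ j"] root_coroot by blast
  \<comment> \<open>A further reflection adds the multiple \<open>(w \<eta>) (\<alpha>v i)\<close>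
    of \<open>\<alpha> i\<close>; its coefficients are those of \<open>\<eta> (\<alpha>v i)\<close>
    minus \<open>m\<close>.\<close>
  let ?n = "\<lambda>j. n j + ((if j = i then 1 else 0) - m j) * k i"
  have "\<phi> (\<eta> - (s i \<circ> w) \<eta>) = (\<Sum>j\<in>UNIV. of_int (?n j) * blinfun_apply \<eta> (\<alpha>v j))" for \<eta>
  proof -
    have "\<eta> - (s i \<circ> w) \<eta> = (\<eta> - w \<eta>) + (\<eta> (\<alpha>v i) - (\<eta> - w \<eta>) (\<alpha>v i)) *\<^sub>R \<alpha> i"
      by (simp add: s_eq blinfun.diff_left)
    then have "\<phi> (\<eta> - (s i \<circ> w) \<eta>) = (\<Sum>j\<in>UNIV. of_int (n j) * blinfun_apply \<eta> (\<alpha>v j)) +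
        (\<eta> (\<alpha>v i) - (\<Sum>j\<in>UNIV. of_int (m j) * blinfun_apply \<eta> (\<alpha>v j))) * of_int (k i)"
      by (simp only: linear_add[OF step.prems(1)] linear_scale[OF step.prems(1)] n m step.prems(2)
          real_scaleR_def)
    also have "\<eta> (\<alpha>v i) = (\<Sum>j\<in>UNIV. of_int (if j = i then 1 else 0) * blinfun_apply \<eta> (\<alpha>v j))"
      by (simp add: if_distrib[of of_int] if_distrib[of "\<lambda>c. c * _"] cong: if_cong)
    finally show ?thesis
      by (simp only: sum_subtractf[symmetric] sum_distrib_right sum.distrib[symmetric])
        (rule sum.cong, auto simp: algebra_simps)
  qed
  then show ?case by (intro exI[of _ ?n]) blast
qed

text \<open>The coefficients are nonnegative because they are heights for the fundamental weights.\<close>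

lemma weyl_subgroup_nat_height:
  assumes "w \<in> weyl_subgroup \<alpha> \<alpha>v I" "linear h" "\<And>i. h (\<alpha> i) = (1 :: real)"
  shows "\<exists>n :: 'n \<Rightarrow> nat. \<forall>\<eta>. h (\<eta> - w \<eta>) = (\<Sum>j\<in>UNIV. of_nat (n j) * blinfun_apply \<eta> (\<alpha>v j))"
proof -
  obtain n :: "'n \<Rightarrow> int"
    where n: "\<And>\<eta>. h (\<eta> - w \<eta>) = (\<Sum>j\<in>UNIV. of_int (n j) * blinfun_apply \<eta> (\<alpha>v j))"
    using weyl_subgroup_int_coefficients[of w I h "\<lambda>_. 1"] assms by auto
  have "0 \<le> n j" for j
  proof -
    obtain \<omega> :: "'h \<Rightarrow>\<^sub>L real" where \<omega>: "\<And>i. \<omega> (\<alpha>v i) = (if i = j then 1 else 0)"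
      using ex_weight[of "\<lambda>i. if i = j then 1 else 0"] by blast
    have "\<omega> \<in> fundamental_chamber \<alpha>v" by (simp add: fundamental_chamber_def \<omega>)
    then have "\<omega> - w \<omega> \<in> nonneg_span \<alpha> I"
      using assms(1) by (intro weyl_orbit_below) (auto simp: weyl_orbit_def)
    then have "0 \<le> h (\<omega> - w \<omega>)"
      by (auto elim!: nonneg_spanE simp: linear_sum[OF assms(2)] linear_scale[OF assms(2)] assms(3)
          intro!: sum_nonneg)
    also have "h (\<omega> - w \<omega>) = of_int (n j)"
      by (simp add: n \<omega> if_distrib cong: if_cong)
    finally show ?thesis by simp
  qed
  then show ?thesis
    using n by (intro exI[of _ "\<lambda>j. nat (n j)"]) simp
qed

section \<open>Moving points of the hull into the chamber\<close>

lemma s_in_hull_orbit: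
  assumes "i \<in> I" "x \<in> convex hull (weyl_orbit \<alpha> \<alpha>v I \<mu>)"
  shows "s i x \<in> convex hull (weyl_orbit \<alpha> \<alpha>v I \<mu>)"
proof -
  have "s i x \<in> convex hull (s i ` weyl_orbit \<alpha> \<alpha>v I \<mu>)"
    using assms(2) convex_hull_linear_image[OF linear_s, of i "weyl_orbit \<alpha> \<alpha>v I \<mu>"] by blast
  also have "\<dots> \<subseteq> convex hull (weyl_orbit \<alpha> \<alpha>v I \<mu>)"
    using s_in_weyl_orbit[OF assms(1)] by (intro hull_mono) auto
  finally show ?thesis .
qed

lemma hull_below:
  assumes "\<mu> \<in> fundamental_chamber \<alpha>v" "x \<in> convex hull (weyl_orbit \<alpha> \<alpha>v I \<mu>)"
  shows "\<mu> - x \<in> nonneg_span \<alpha> I"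
proof -
  have "convex hull (weyl_orbit \<alpha> \<alpha>v I \<mu>) \<subseteq> {x. \<mu> - x \<in> nonneg_span \<alpha> I}"
    using weyl_orbit_below[OF assms(1)] by (intro hull_minimal convex_diff_nonneg_span) auto
  with assms(2) show ?thesis by blast
qed

text \<open>
  Reflecting \<open>x\<close> at a negative value lowers its height below \<open>\<mu>\<close>.  The convex coefficients of \<open>x\<close>
  stay fixed along the way, so all heights lie in a finitely generated monoid of nonnegative
  reals, and the process stops even if the Weyl group is infinite.
\<close>

lemma hull_to_chamber:
  assumes "\<mu> \<in> fundamental_chamber \<alpha>v" "x \<in> convex hull (weyl_orbit \<alpha> \<alpha>v I \<mu>)"
  shows "\<exists>v \<in> weyl_subgroup \<alpha> \<alpha>v I. \<exists>w \<in> weyl_subgroup \<alpha> \<alpha>v I.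
    v x \<in> fundamental_chamber \<alpha>v \<and> w (v x) = x"
proof -
  let ?O = "weyl_orbit \<alpha> \<alpha>v I \<mu>"
  obtain S u where S: "finite S" "S \<subseteq> ?O" "\<And>v. v \<in> S \<Longrightarrow> 0 \<le> u v" "sum u S = 1"
    and x: "x = (\<Sum>v\<in>S. u v *\<^sub>R v)"
    using assms(2) by (auto simp: convex_hull_explicit)
  obtain h where h: "linear h" "\<And>i. h (\<alpha> i) = (1 :: real)"
    using ex_functional[of "\<lambda>_. 1"] by blast
  \<comment> \<open>All points obtained from \<open>x\<close> by exchanging its orbit points while
    keeping the coefficients \<open>u\<close>; reflections from \<open>I\<close> do not leave this
    set.\<close>
  define X where "X = {\<Sum>v\<in>S. u v *\<^sub>R f v | f. f ` S \<subseteq> ?O}"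
  \<comment> \<open>The monoid of possible heights; its generators are nonnegative as \<mu> is
    dominant.\<close>
  define M where "M = {m. \<exists>n :: _ \<times> 'n \<Rightarrow> nat. m = (\<Sum>k\<in>S \<times> UNIV. of_nat (n k) * (u (fst k) * \<mu> (\<alpha>v (snd k))))}"
  have fin: "finite {m. m \<in> M \<and> m \<le> b}" for b
    unfolding M_def mem_Collect_eq using S(1,3) assms(1)
    by (intro finite_nat_combinations_le) (auto simp: fundamental_chamber_def)
  have X_hull: "X \<subseteq> convex hull ?O"
    using S by (auto simp: X_def intro!: convex_sum[OF _ convex_convex_hull] intro: hull_inc)
  have X_M: "h (\<mu> - z) \<in> M" if z: "z \<in> X" for z
  proof -
    obtain f where f: "z = (\<Sum>v\<in>S. u v *\<^sub>R f v)" "f ` S \<subseteq> ?O"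
      using z by (auto simp: X_def)
    have "\<exists>n :: 'n \<Rightarrow> nat. h (\<mu> - f v) = (\<Sum>j\<in>UNIV. of_nat (n j) * blinfun_apply \<mu> (\<alpha>v j))"
      if "v \<in> S" for v
      using f(2) that weyl_subgroup_nat_height[OF _ h] unfolding weyl_orbit_def by fastforce
    then obtain n :: "_ \<Rightarrow> 'n \<Rightarrow> nat"
      where n: "\<And>v. v \<in> S \<Longrightarrow> h (\<mu> - f v) = (\<Sum>j\<in>UNIV. of_nat (n v j) * blinfun_apply \<mu> (\<alpha>v j))"
      by metis
    have "\<mu> - z = (\<Sum>v\<in>S. u v *\<^sub>R (\<mu> - f v))"
      by (simp add: f(1) scaleR_diff_right sum_subtractf S(4) flip: scaleR_sum_left)
    then have "h (\<mu> - z) = (\<Sum>v\<in>S. u v * (\<Sum>j\<in>UNIV. of_nat (n v j) * blinfun_apply \<mu> (\<alpha>v j)))"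
      by (simp add: linear_sum[OF h(1)] linear_scale[OF h(1)] n)
    also have "\<dots> = (\<Sum>k\<in>S \<times> UNIV. of_nat (case_prod n k) * (u (fst k) * \<mu> (\<alpha>v (snd k))))"
      by (simp add: sum.cartesian_product' sum_distrib_left algebra_simps)
    finally show ?thesis unfolding M_def by blast
  qed
  have "\<exists>v \<in> weyl_subgroup \<alpha> \<alpha>v I. \<exists>w \<in> weyl_subgroup \<alpha> \<alpha>v I.
      v z \<in> fundamental_chamber \<alpha>v \<and> w (v z) = z" if "z \<in> X" for z
    using that
  proof (induction "card {m. m \<in> M \<and> m \<le> h (\<mu> - z)}" arbitrary: z rule: less_induct)
    case less
    show ?case
    proof (cases "\<forall>i\<in>I. 0 \<le> blinfun_apply z (\<alpha>v i)")
      case True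
      moreover have "0 \<le> blinfun_apply z (\<alpha>v i)" if "i \<notin> I" for i
        using below_dominant[OF assms(1) hull_below[OF assms(1)] that] X_hull less.prems by blast
      ultimately have "z \<in> fundamental_chamber \<alpha>v"
        by (auto simp: fundamental_chamber_def)
      then show ?thesis
        using id_in_weyl_subgroup by (intro bexI[of _ id]) auto
    next
      case False
      then obtain i where i: "i \<in> I" "blinfun_apply z (\<alpha>v i) < 0" by force
      obtain f where f: "z = (\<Sum>v\<in>S. u v *\<^sub>R f v)" "f ` S \<subseteq> ?O"
        using less.prems by (auto simp: X_def)
      have "s i z = (\<Sum>v\<in>S. u v *\<^sub>R s i (f v))"
        by (simp add: f(1) linear_sum[OF linear_s] linear_scale[OF linear_s])
      then have X: "s i z \<in> X"
        using f(2) s_in_weyl_orbit[OF i(1)] unfolding X_def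
        by (intro CollectI exI[of _ "\<lambda>v. s i (f v)"]) auto
      have "\<mu> - s i z = (\<mu> - z) + z (\<alpha>v i) *\<^sub>R \<alpha> i" by (simp add: s_eq)
      then have "h (\<mu> - s i z) = h (\<mu> - z) + z (\<alpha>v i)"
        by (simp only: linear_add[OF h(1)] linear_scale[OF h(1)] h(2) real_scaleR_def mult_1_right)
      with i(2) have "h (\<mu> - s i z) < h (\<mu> - z)" by simp
      \<comment> \<open>The old height belongs to the larger set only, so the count of possible
        heights drops.\<close>
      then have "{m. m \<in> M \<and> m \<le> h (\<mu> - s i z)} \<subset> {m. m \<in> M \<and> m \<le> h (\<mu> - z)}"
        using X_M[OF less.prems] by force
      from less.hyps[OF psubset_card_mono[OF fin this] X]
      obtain v w where vw: "v \<in> weyl_subgroup \<alpha> \<alpha>v I" "w \<in> weyl_subgroup \<alpha> \<alpha>v I"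
        "v (s i z) \<in> fundamental_chamber \<alpha>v" "w (v (s i z)) = s i z" by blast
      then show ?thesis
        using weyl_subgroup_comp[OF _ s_in_weyl_subgroup[OF i(1)]]
          weyl_subgroup_comp[OF s_in_weyl_subgroup[OF i(1)]]
        by (intro bexI[of _ "v \<circ> s i"] bexI[of _ "s i \<circ> w"]) simp_all
    qed
  qed
  moreover have "x \<in> X" using S(2) x unfolding X_def by (intro CollectI exI[of _ "\<lambda>v. v"]) auto
  ultimately show ?thesis by blast
qed

lemma hull_eq_weyl_translates:
  fixes \<mu> :: "'h \<Rightarrow>\<^sub>L real" and I :: "'n set"
  assumes "\<mu> \<in> fundamental_chamber \<alpha>v"
  defines "F \<equiv> convex hull (weyl_orbit \<alpha> \<alpha>v I \<mu>)"
  shows "F = (\<Union>w \<in> weyl_subgroup \<alpha> \<alpha>v I. w ` (F \<inter> fundamental_chamber \<alpha>v))"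
proof -
  have stable: "w x \<in> F" if "w \<in> weyl_subgroup \<alpha> \<alpha>v I" "x \<in> F" for w x
    using weyl_subgroup_stable[OF that] s_in_hull_orbit unfolding F_def by blast
  show ?thesis
  proof (intro equalityI subsetI)
    fix x assume x: "x \<in> F"
    then obtain v w where vw: "v \<in> weyl_subgroup \<alpha> \<alpha>v I" "w \<in> weyl_subgroup \<alpha> \<alpha>v I"
      "v x \<in> fundamental_chamber \<alpha>v" "w (v x) = x"
      using hull_to_chamber[OF assms(1)] unfolding F_def by blast
    then show "x \<in> (\<Union>w \<in> weyl_subgroup \<alpha> \<alpha>v I. w ` (F \<inter> fundamental_chamber \<alpha>v))"
      using stable[OF vw(1) x] by (intro UN_I[OF vw(2)] image_eqI[of _ _ "v x"]) auto
  qed (use stable in auto)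
qed

lemma rel_interior_hull_meets_chamber:
  fixes \<mu> :: "'h \<Rightarrow>\<^sub>L real" and I :: "'n set"
  assumes "\<mu> \<in> fundamental_chamber \<alpha>v"
  defines "F \<equiv> convex hull (weyl_orbit \<alpha> \<alpha>v I \<mu>)"
  shows "rel_interior F \<inter> fundamental_chamber \<alpha>v \<noteq> {}"
proof -
  have "F \<noteq> {}" using base_in_weyl_orbit by (auto simp: F_def)
  then obtain x where x: "x \<in> rel_interior F"
    using rel_interior_dual_nonempty[of F] by (auto simp: F_def)
  then have "x \<in> F" using rel_interior_subset by blast
  then obtain v where v: "v \<in> weyl_subgroup \<alpha> \<alpha>v I" "v x \<in> fundamental_chamber \<alpha>v"
    using hull_to_chamber[OF assms(1)] unfolding F_def by blast
  \<comment> \<open>A simple reflection from \<open>I\<close> is an involutive homeomorphism mapping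
    \<open>F\<close> onto itself; stability then passes to \<open>v\<close>.\<close>
  have "s i y \<in> rel_interior F" if "i \<in> I" "y \<in> rel_interior F" for i y
  proof -
    have "bounded_linear (s i)"
      unfolding simple_reflection_def
      by (intro bounded_linear_sub bounded_linear_ident bounded_linear_scaleR_const
          blinfun.bounded_linear_left)
    moreover have "s i ` F = F"
    proof
      show sub: "s i ` F \<subseteq> F" using s_in_hull_orbit[OF that(1)] by (auto simp: F_def)
      show "F \<subseteq> s i ` F"
      proof
        fix x assume "x \<in> F"
        then show "x \<in> s i ` F" using sub by (intro image_eqI[of _ _ "s i x"]) auto
      qed
    qed
    ultimately show ?thesis
      using rel_interior_linear_homeomorphism[of "s i" "s i" y F] that(2) by simp
  qed
  then have "v x \<in> rel_interior F" by (rule weyl_subgroup_stable[OF v(1) x])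
  with v(2) show ?thesis by blast
qed

text \<open>The value of \<phi> on \<open>\<mu> - x\<close> is the sum of the coefficients outside
  \<open>I\<close>. The two equalities follow from a cycle of three inclusions.\<close>

lemma maximizers_eq_hull:
  fixes \<mu> :: "'h \<Rightarrow>\<^sub>L real" and I :: "'n set"
  assumes "\<mu> \<in> fundamental_chamber \<alpha>v" "linear \<phi>" "\<And>i. \<phi> (\<alpha> i) = (if i \<in> I then 0 else 1 :: real)"
  defines "H \<equiv> convex hull (weyl_orbit \<alpha> \<alpha>v UNIV \<mu>)" and "F \<equiv> convex hull (weyl_orbit \<alpha> \<alpha>v I \<mu>)"
  shows "x \<in> H \<Longrightarrow> \<phi> x \<le> \<phi> \<mu>" and "F = {x \<in> H. \<phi> x = \<phi> \<mu>}"
    and "F = H \<inter> {\<mu> - \<beta> | \<beta>. \<beta> \<in> nonneg_span \<alpha> I}"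
proof -
  interpret \<phi>: linear \<phi> by fact
  have \<phi>_pos: "0 \<le> \<phi> \<beta>" if "\<beta> \<in> nonneg_span \<alpha> UNIV" for \<beta>
    using that by (auto elim!: nonneg_spanE simp: \<phi>.sum \<phi>.scale assms(3) intro!: sum_nonneg)
  have \<phi>_zero: "\<beta> \<in> nonneg_span \<alpha> I" if \<beta>: "\<beta> \<in> nonneg_span \<alpha> UNIV" "\<phi> \<beta> = 0" for \<beta>
  proof -
    obtain c where c: "\<beta> = (\<Sum>i\<in>UNIV. c i *\<^sub>R \<alpha> i)" "\<And>i. 0 \<le> c i"
      using \<beta>(1) unfolding nonneg_span_def by blast
    have "(\<Sum>i\<in>UNIV. c i * (if i \<in> I then 0 else 1)) = 0"
      using \<beta>(2) by (simp add: c(1) \<phi>.sum \<phi>.scale assms(3))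
    then have "c i * (if i \<in> I then 0 else 1) = 0" for i
      using c(2) by (subst (asm) sum_nonneg_eq_0_iff) auto
    then have "c i = 0" if "i \<notin> I" for i using that by (metis mult_cancel_left1)
    then have "\<beta> = (\<Sum>i\<in>I. c i *\<^sub>R \<alpha> i)"
      unfolding c(1) by (intro sum.mono_neutral_right) auto
    then show ?thesis using nonneg_spanI[of I c] c(2) by simp
  qed
  have below: "\<mu> - x \<in> nonneg_span \<alpha> UNIV" if "x \<in> H" for x
    using hull_below[OF assms(1)] that by (simp add: H_def)
  have le: "\<phi> x \<le> \<phi> \<mu>" if "x \<in> H" for x
    using \<phi>_pos[OF below[OF that]] by (simp add: \<phi>.diff)
  then show "x \<in> H \<Longrightarrow> \<phi> x \<le> \<phi> \<mu>" .
  have "F \<subseteq> H" unfolding F_def H_def by (intro hull_mono weyl_orbit_mono) simp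
  have "F \<subseteq> H \<inter> {\<mu> - \<beta> | \<beta>. \<beta> \<in> nonneg_span \<alpha> I}"
  proof
    fix x assume x: "x \<in> F"
    then have "\<mu> - x \<in> nonneg_span \<alpha> I"
      using hull_below[OF assms(1)] by (simp add: F_def)
    moreover have "x = \<mu> - (\<mu> - x)" by simp
    ultimately show "x \<in> H \<inter> {\<mu> - \<beta> | \<beta>. \<beta> \<in> nonneg_span \<alpha> I}"
      using x \<open>F \<subseteq> H\<close> by blast
  qed
  moreover have "H \<inter> {\<mu> - \<beta> | \<beta>. \<beta> \<in> nonneg_span \<alpha> I} \<subseteq> {x \<in> H. \<phi> x = \<phi> \<mu>}"
    by (auto elim!: nonneg_spanE simp: \<phi>.diff \<phi>.sum \<phi>.scale assms(3))
  moreover have "{x \<in> H. \<phi> x = \<phi> \<mu>} \<subseteq> F"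
  proof clarify
    fix x assume x: "x \<in> H" "\<phi> x = \<phi> \<mu>"
    obtain S u where S: "finite S" "S \<subseteq> weyl_orbit \<alpha> \<alpha>v UNIV \<mu>" "\<And>v. v \<in> S \<Longrightarrow> 0 \<le> u v"
      "sum u S = 1" and xS: "(\<Sum>v\<in>S. u v *\<^sub>R v) = x"
      using x(1) by (auto simp: H_def convex_hull_explicit)
    have SH: "v \<in> H" if "v \<in> S" for v using S(2) that by (auto simp: H_def hull_inc)
    have "(\<Sum>v\<in>S. u v * (\<phi> \<mu> - \<phi> v)) = 0"
      using x(2) S(4)
      by (simp add: xS[symmetric] \<phi>.sum \<phi>.scale right_diff_distrib sum_subtractf flip: sum_distrib_right)
    then have zero: "u v * (\<phi> \<mu> - \<phi> v) = 0" if "v \<in> S" for v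
      using S(1,3) le[OF SH] that by (subst (asm) sum_nonneg_eq_0_iff) auto
    \<comment> \<open>Maximality at \<open>x\<close> forces it at each orbit point of nonzero
      coefficient. Points of coefficient 0 may lie outside \<open>F\<close> and are dropped
      below.\<close>
    have "v \<in> F" if "v \<in> S" "u v \<noteq> 0" for v
    proof -
      have "\<mu> - v \<in> nonneg_span \<alpha> I"
        using \<phi>_zero[OF below[OF SH[OF that(1)]]] zero[OF that(1)] that(2) by (simp add: \<phi>.diff)
      then show ?thesis
        using weyl_orbit_Int_below[OF assms(1)] S(2) that(1) by (auto simp: F_def intro!: hull_inc)
    qed
    then have "(\<Sum>v\<in>{v \<in> S. u v \<noteq> 0}. u v *\<^sub>R v) \<in> F"
      using S by (intro convex_sum) (auto simp: F_def sum.mono_neutral_cong_left[of S "{v \<in> S. u v \<noteq> 0}" u u])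
    also have "(\<Sum>v\<in>{v \<in> S. u v \<noteq> 0}. u v *\<^sub>R v) = x"
      unfolding xS[symmetric] using S(1) by (intro sum.mono_neutral_left) auto
    finally show "x \<in> F" .
  qed
  ultimately show "F = {x \<in> H. \<phi> x = \<phi> \<mu>}" "F = H \<inter> {\<mu> - \<beta> | \<beta>. \<beta> \<in> nonneg_span \<alpha> I}"
    by blast+
qed

end

theorem theorem3p3:
  fixes A :: "int^'n^'n"
    and \<alpha> :: "'n \<Rightarrow> ('h::euclidean_space \<Rightarrow>\<^sub>L real)"
    and \<alpha>v :: "'n \<Rightarrow> 'h"
    and \<mu> :: "'h \<Rightarrow>\<^sub>L real"
    and I :: "'n set"
  assumes "generalized_cartan_matrix A"
    and "realization A \<alpha> \<alpha>v"
    and "\<mu> \<in> fundamental_chamber \<alpha>v"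
  shows "let H = convex hull (weyl_orbit \<alpha> \<alpha>v UNIV \<mu>);
             F = convex hull (weyl_orbit \<alpha> \<alpha>v I \<mu>)
         in exposed_face F H \<and> fundamental_face \<alpha>v F H \<and>
            F = H \<inter> {\<mu> - \<beta> | \<beta>. \<beta> \<in> nonneg_span \<alpha> I} \<and>
            F = (\<Union>w \<in> weyl_subgroup \<alpha> \<alpha>v I. w ` (F \<inter> fundamental_chamber \<alpha>v)) \<and>
            weyl_orbit \<alpha> \<alpha>v I \<mu> = F \<inter> weyl_orbit \<alpha> \<alpha>v UNIV \<mu>"
proof -
  interpret gcm_realization A \<alpha> \<alpha>v
    by (rule gcm_realization.intro) (use assms(1,2) in auto)
  let ?H = "convex hull (weyl_orbit \<alpha> \<alpha>v UNIV \<mu>)" and ?F = "convex hull (weyl_orbit \<alpha> \<alpha>v I \<mu>)"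
  obtain \<phi> where \<phi>: "linear \<phi>" "\<And>i. \<phi> (\<alpha> i) = (if i \<in> I then 0 else 1 :: real)"
    using ex_functional[of "\<lambda>i. if i \<in> I then 0 else 1"] by blast
  note max = maximizers_eq_hull[OF assms(3) \<phi>]
  \<comment> \<open>The bound \<open>\<phi> \<mu>\<close> is attained, so its level set in
    \<open>?H\<close> is the set of maximizers.\<close>
  have "\<mu> \<in> ?H" by (simp add: hull_inc base_in_weyl_orbit)
  then have "{x \<in> ?H. \<phi> x = \<phi> \<mu>} = {x \<in> ?H. \<forall>y\<in>?H. \<phi> y \<le> \<phi> x}"
    using max(1) by (auto intro: antisym)
  then have exposed: "exposed_face ?F ?H"
    unfolding exposed_face_def using \<phi>(1) max(2) by auto
  have fundamental: "fundamental_face \<alpha>v ?F ?H"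
    using face_of_maximizers[OF \<phi>(1) convex_convex_hull, of "weyl_orbit \<alpha> \<alpha>v UNIV \<mu>" "\<phi> \<mu>"]
      max(1) rel_interior_hull_meets_chamber[OF assms(3), of I]
    unfolding fundamental_face_def max(2)[symmetric] by blast
  have orbit: "weyl_orbit \<alpha> \<alpha>v I \<mu> = ?F \<inter> weyl_orbit \<alpha> \<alpha>v UNIV \<mu>"
  proof
    show "weyl_orbit \<alpha> \<alpha>v I \<mu> \<subseteq> ?F \<inter> weyl_orbit \<alpha> \<alpha>v UNIV \<mu>"
      using weyl_orbit_mono[of I UNIV] by (simp add: hull_subset)
    show "?F \<inter> weyl_orbit \<alpha> \<alpha>v UNIV \<mu> \<subseteq> weyl_orbit \<alpha> \<alpha>v I \<mu>"
      using hull_below[OF assms(3)] weyl_orbit_Int_below[OF assms(3)] by blast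
  qed
  show ?thesis
    unfolding Let_def
    by (intro conjI exposed fundamental max(3) hull_eq_weyl_translates[OF assms(3)] orbit)
qed

end
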